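(* Let $n\ge 1$ and let $T: S_n(\mathbb{R})\to S_n(\mathbb{R})$ be a linear transformation preserving positive definiteness and such that $\operatorname{rank} T(E_{ii})=1$ for $i=1,2,\ldots,n$. Then there exist an invertible matrix $W\in M_n(\mathbb{R})$ and a positive semi-definite matrix $H\in S_n(\mathbb{R})$ all of whose diagonal entries are equal to $1$ (that is, $\operatorname{diag} H=\operatorname{diag} I_n$), such that for every $A\in S_n(\mathbb{R})$ $$T(A)=W(H\circ A)W^t.$$
   Context: $M_n(\mathbb{R})$ is the space of real $n\times n$ matrices and $S_n(\mathbb{R})$ is the real vector space of real symmetric $n\times n$ matrices. $E_{ii}$ is the $n\times n$ matrix with $1$ in position $(i,i)$ and zeros elsewhere. A linear map $T$ on $S_n(\mathbb{R})$ preserves positive definiteness if $T(A)$ is positive definite whenever $A\in S_n(\mathbb{R})$ is positive definite. The symbol $\circ$ denotes the Hadamard (entrywise) product: $(a_{ij})\circ(b_{ij})=(a_{ij}b_{ij})$. $W^t$ is the transpose of $W$. *)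

theory Defs
  imports "HOL-Analysis.Analysis"
begin

definition sym_matrices :: "(real ^ 'n ^ 'n) set" where
  "sym_matrices = {A. transpose A = A}"

definition pos_definite :: "real ^ 'n ^ 'n \<Rightarrow> bool" where
  "pos_definite A \<longleftrightarrow> A \<in> sym_matrices \<and> (\<forall>x. x \<noteq> 0 \<longrightarrow> x \<bullet> (A *v x) > 0)"

definition pos_semidefinite :: "real ^ 'n ^ 'n \<Rightarrow> bool" where
  "pos_semidefinite A \<longleftrightarrow> A \<in> sym_matrices \<and> (\<forall>x. x \<bullet> (A *v x) \<ge> 0)"

definition diag_unit :: "'n \<Rightarrow> real ^ 'n ^ 'n" where
  "diag_unit k = (\<chi> i j. if i = k \<and> j = k then 1 else 0)"

definition hadamard :: "real ^ 'n ^ 'n \<Rightarrow> real ^ 'n ^ 'n \<Rightarrow> real ^ 'n ^ 'n" where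
  "hadamard A B = (\<chi> i j. A $ i $ j * B $ i $ j)"

text \<open>
  A linear map from the space of symmetric matrices to itself is represented by a function on
  all matrices that is constrained only on the symmetric ones: its values elsewhere are
  arbitrary, so it need not be linear on the whole matrix space.
\<close>

definition linear_on_sym :: "(real ^ 'n ^ 'n \<Rightarrow> real ^ 'n ^ 'n) \<Rightarrow> bool" where
  "linear_on_sym T \<longleftrightarrow>
     (\<forall>A \<in> sym_matrices. T A \<in> sym_matrices) \<and>
     (\<forall>A \<in> sym_matrices. \<forall>B \<in> sym_matrices. T (A + B) = T A + T B) \<and>
     (\<forall>c. \<forall>A \<in> sym_matrices. T (c *\<^sub>R A) = c *\<^sub>R T A)"

definition preserves_pos_definite :: "(real ^ 'n ^ 'n \<Rightarrow> real ^ 'n ^ 'n) \<Rightarrow> bool" where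
  "preserves_pos_definite T \<longleftrightarrow> (\<forall>A. pos_definite A \<longrightarrow> pos_definite (T A))"

end

theory Submission
  imports Defs
begin

text \<open>
  By continuity \<open>T\<close> preserves positive semidefiniteness, so \<open>T E\<^sub>i\<^sub>i = w\<^sub>i w\<^sub>i\<^sup>t\<close>; the vectors \<open>w\<^sub>i\<close> are
  the columns of a matrix \<open>W\<close>, invertible because \<open>W W\<^sup>t = T I\<close> is positive definite. The map
  \<open>S A = W\<^sup>-\<^sup>1 (T A) W\<^sup>-\<^sup>t\<close> fixes every \<open>E\<^sub>i\<^sub>i\<close>. Applying \<open>S\<close> to the squares of \<open>a e\<^sub>i + b e\<^sub>j\<close> for
  all real \<open>a, b\<close> shows that the quadratic form of \<open>S (E\<^sub>i\<^sub>j + E\<^sub>j\<^sub>i)\<close> vanishes at every \<open>y\<close>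
  with \<open>y\<^sub>i = 0\<close> or \<open>y\<^sub>j = 0\<close>, so this matrix is a multiple of \<open>E\<^sub>i\<^sub>j + E\<^sub>j\<^sub>i\<close>. Hence \<open>S\<close> is the
  Hadamard product with the image \<open>H = S J\<close> of the all-ones matrix \<open>J\<close>.
\<close>

section \<open>Symmetric matrices and maps linear on them\<close>

lemma sym_matrices_iff: "A \<in> sym_matrices \<longleftrightarrow> (\<forall>i j. A $ i $ j = A $ j $ i)"
  by (auto simp: sym_matrices_def transpose_def vec_eq_iff)

lemma sym_matrices_add: "A \<in> sym_matrices \<Longrightarrow> B \<in> sym_matrices \<Longrightarrow> A + B \<in> sym_matrices"
  by (simp add: sym_matrices_iff)

lemma sym_matrices_scaleR: "A \<in> sym_matrices \<Longrightarrow> c *\<^sub>R A \<in> sym_matrices"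
  by (simp add: sym_matrices_iff)

lemma sym_matrices_sum: "(\<And>i. i \<in> I \<Longrightarrow> f i \<in> sym_matrices) \<Longrightarrow> sum f I \<in> sym_matrices"
  by (simp add: sym_matrices_iff)

lemma linear_on_sym_sum:
  assumes "linear_on_sym T" "\<And>i. i \<in> I \<Longrightarrow> f i \<in> sym_matrices"
  shows "T (sum f I) = (\<Sum>i\<in>I. T (f i))"
proof -
  \<comment> \<open>Settles the empty index set and also an infinite one, where a sum is 0 by
    convention.\<close>
  have z: "T 0 = 0"
  proof -
    have "(0 :: real^'a^'a) \<in> sym_matrices" by (simp add: sym_matrices_iff)
    then have "T (0 *\<^sub>R 0) = 0 *\<^sub>R T 0" using assms(1) unfolding linear_on_sym_def by blast
    then show ?thesis by simp
  qed
  show ?thesis using assms(2)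
  proof (induction I rule: infinite_finite_induct)
    case (insert x F)
    then have "T (f x + sum f F) = T (f x) + T (sum f F)"
      using assms(1) sym_matrices_sum[of F f] unfolding linear_on_sym_def by blast
    with insert show ?case by simp
  qed (simp_all add: z)
qed

section \<open>Positive semidefinite matrices and quadratic forms\<close>

lemma pos_semidefinite_image:
  fixes T :: "real ^ 'n ^ 'n \<Rightarrow> real ^ 'n ^ 'n"
  assumes T: "linear_on_sym T" "preserves_pos_definite T" and A: "pos_semidefinite A"
  shows "pos_semidefinite (T A)"
proof -
  have symA: "A \<in> sym_matrices" and symI: "(mat 1 :: real^'n^'n) \<in> sym_matrices"
    using A by (simp_all add: pos_semidefinite_def sym_matrices_def)
  have "x \<bullet> (T A *v x) \<ge> 0" for x
  proof (cases "x = 0")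
    case False
    \<comment> \<open>\<open>A\<close> may be singular, but adding \<open>e\<close> times the
      identity makes it positive definite for every \<open>e > 0\<close>. By linearity the form of
      the image is affine in \<open>e\<close>, so it stays nonnegative as \<open>e\<close> tends to
      0 from the right.\<close>
    have *: "x \<bullet> (T A *v x) + e * (x \<bullet> (T (mat 1) *v x)) > 0" if e: "e > 0" for e
    proof -
      have "pos_definite (A + e *\<^sub>R mat 1)"
        unfolding pos_definite_def
      proof (intro conjI allI impI)
        fix v :: "real^'n" assume "v \<noteq> 0"
        then show "v \<bullet> ((A + e *\<^sub>R mat 1) *v v) > 0"
          using A e by (simp add: pos_semidefinite_def matrix_vector_mult_add_rdistrib
              scaleR_matrix_vector_assoc[symmetric] inner_add_right add_nonneg_pos)
      qed (use symA symI in \<open>simp add: sym_matrices_add sym_matrices_scaleR\<close>)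
      then have "pos_definite (T (A + e *\<^sub>R mat 1))"
        using T(2) by (simp add: preserves_pos_definite_def)
      also have "T (A + e *\<^sub>R mat 1) = T A + e *\<^sub>R T (mat 1)"
        using T(1) symA symI sym_matrices_scaleR unfolding linear_on_sym_def by metis
      finally show ?thesis
        using False by (simp add: pos_definite_def matrix_vector_mult_add_rdistrib
              scaleR_matrix_vector_assoc[symmetric] inner_add_right)
    qed
    have "((\<lambda>e. x \<bullet> (T A *v x) + e * (x \<bullet> (T (mat 1) *v x))) \<longlongrightarrow>
        x \<bullet> (T A *v x) + 0 * (x \<bullet> (T (mat 1) *v x))) (at_right 0)"
      by (intro tendsto_intros)
    moreover have "eventually (\<lambda>e. 0 \<le> x \<bullet> (T A *v x) + e * (x \<bullet> (T (mat 1) *v x))) (at_right 0)"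
      using eventually_at_right_less[of "0::real"] by eventually_elim (use * in \<open>auto intro: less_imp_le\<close>)
    ultimately show ?thesis
      by (auto dest!: tendsto_lowerbound)
  qed simp
  then show ?thesis
    using T(1) symA by (simp add: pos_semidefinite_def linear_on_sym_def)
qed

text \<open>The range is a line spanned by some \<open>u\<close>, so
  \<open>A *v x = f x *\<^sub>R u\<close>. Symmetry makes \<open>f\<close> proportional to the inner
  product with \<open>u\<close>, which gives \<open>A\<close> = c u u^t, and semidefiniteness allows
  the square root of c to be absorbed into \<open>u\<close>.\<close>

lemma pos_semidefinite_rank_1:
  fixes A :: "real^'n^'n"
  assumes A: "pos_semidefinite A" and r: "rank A = 1"
  shows "\<exists>w. A = (\<chi> k l. w $ k * w $ l)"
proof -
  obtain u where u: "u \<noteq> 0" "range ((*v) A) \<subseteq> span {u}"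
  proof -
    have d: "dim (range ((*v) A)) = 1"
      using r by (simp add: rank_dim_range)
    obtain B where B: "B \<subseteq> range ((*v) A)" "independent B" "range ((*v) A) \<subseteq> span B"
      "card B = dim (range ((*v) A))"
      using basis_exists by blast
    with d obtain u where "B = {u}" by (metis card_1_singletonE)
    with B that show thesis by (metis dependent_single)
  qed
  have "\<exists>f. A *v x = f *\<^sub>R u" for x
    using u(2) by (auto simp: span_singleton)
  then obtain f where f: "\<And>x. A *v x = f x *\<^sub>R u" by metis
  have "transpose A = A"
    using A by (simp add: pos_semidefinite_def sym_matrices_def)
  then have sym: "x \<bullet> (A *v y) = y \<bullet> (A *v x)" for x y
    using dot_lmul_matrix[of x A y] transpose_matrix_vector[of A x] inner_commute[of y "A *v x"]
    by simp
  \<comment> \<open>Symmetry applied to \<open>x\<close> and \<open>u\<close> reads f(x) (u . u) =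
    f(u) (x . u), and this dictates the constant.\<close>
  define c where "c = f u / (u \<bullet> u)"
  have fx: "f x = c * (x \<bullet> u)" for x
    using sym[of x u] u(1) by (simp add: f c_def field_simps)
  have "u \<bullet> (A *v u) \<ge> 0"
    using A by (simp add: pos_semidefinite_def)
  then have "c \<ge> 0"
    using u(1) by (simp add: f c_def zero_le_mult_iff zero_le_divide_iff)
  have "A $ k $ l = (sqrt c *\<^sub>R u) $ k * (sqrt c *\<^sub>R u) $ l" for k l
  proof -
    have "A $ k $ l = (A *v axis l 1) $ k"
      by (simp add: matrix_vector_mult_basis column_def)
    also have "\<dots> = c * u $ l * u $ k"
      by (simp add: f fx inner_axis')
    finally show ?thesis
      using \<open>c \<ge> 0\<close> by simp
  qed
  then show ?thesis by (intro exI[of _ "sqrt c *\<^sub>R u"]) (simp add: vec_eq_iff)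
qed

text \<open>Moving the congruence onto the vector serves twice in the theorem: for the injectivity
  of \<open>transpose W\<close> and for the semidefiniteness of \<open>S A\<close>.\<close>

lemma inner_congruence:
  fixes M A :: "real^'n^'n"
  shows "x \<bullet> ((M ** A ** transpose M) *v x) = (transpose M *v x) \<bullet> (A *v (transpose M *v x))"
  by (simp add: matrix_vector_mul_assoc[symmetric] dot_lmul_matrix[symmetric])

text \<open>If \<open>p = 0\<close>, fixing b = 1 leaves the affine function a q + r, which cannot
  be bounded below unless \<open>q = 0\<close>; the case \<open>r = 0\<close> is the same with a =
  1. The values chosen below make the expression equal to -1.\<close>

lemma quadratic_form_vanishes:
  fixes p q r :: real
  assumes "\<And>a b. 0 \<le> a\<^sup>2 * p + a * b * q + b\<^sup>2 * r" and "p = 0 \<or> r = 0"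
  shows "q = 0"
proof (rule ccontr)
  assume q: "q \<noteq> 0"
  show False
  proof (cases "p = 0")
    case True
    then show False
      using assms(1)[of "- (r + 1) / q" 1] q by simp
  next
    case False
    then show False
      using assms(1)[of 1 "- (p + 1) / q"] assms(2) q by simp
  qed
qed

section \<open>Diagonal units and symmetrised matrix units\<close>

lemma diag_unit_sym: "diag_unit i \<in> sym_matrices"
  by (auto simp: diag_unit_def sym_matrices_iff)

lemma inner_diag_unit: "y \<bullet> (diag_unit i *v y) = (y $ i)\<^sup>2"
proof -
  have *: "(diag_unit i *v y) $ k = (if k = i then y $ i else 0)" for k
    by (cases "k = i")
      (simp_all add: diag_unit_def matrix_vector_mult_def if_distrib if_distribR cong: if_cong)
  then show ?thesis
    by (simp add: inner_vec_def * power2_eq_square if_distrib cong: if_cong)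
qed

text \<open>This is E_ij + E_ji, which for \<open>i = j\<close> is twice the diagonal unit. With
  that convention one factor 1/2 suits every ordered pair in the expansion of a symmetric
  matrix.\<close>

definition sym_unit :: "'n \<Rightarrow> 'n \<Rightarrow> real ^ 'n ^ 'n" where
  "sym_unit i j = (\<chi> k l. of_bool (k = i \<and> l = j) + of_bool (l = i \<and> k = j))"

lemma sym_unit_sym: "sym_unit i j \<in> sym_matrices"
  by (auto simp: sym_unit_def sym_matrices_iff)

lemma sym_matrix_eq_sum:
  assumes "A \<in> sym_matrices"
  shows "A = (\<Sum>i\<in>UNIV. \<Sum>j\<in>UNIV. (A $ i $ j / 2) *\<^sub>R sym_unit i j)"
proof -
  have "(\<Sum>i\<in>UNIV. \<Sum>j\<in>UNIV. A $ i $ j / 2 * (of_bool (k = i \<and> l = j) + of_bool (l = i \<and> k = j)))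
      = A $ k $ l / 2 + A $ l $ k / 2" for k l
  proof -
    have delta: "(\<Sum>i\<in>UNIV. \<Sum>j\<in>UNIV. f i j * of_bool (a = i \<and> b = j)) = f a b"
      for f :: "'a \<Rightarrow> 'a \<Rightarrow> real" and a b
    proof -
      have "(\<Sum>j\<in>UNIV. f i j * of_bool (a = i \<and> b = j)) = (if a = i then f i b else 0)" for i
        by (cases "a = i") (simp_all add: of_bool_def if_distrib cong: if_cong)
      then show ?thesis by simp
    qed
    have "(\<Sum>i\<in>UNIV. \<Sum>j\<in>UNIV. A $ i $ j / 2 * of_bool (k = i \<and> l = j)) = A $ k $ l / 2"
         "(\<Sum>i\<in>UNIV. \<Sum>j\<in>UNIV. A $ i $ j / 2 * of_bool (l = i \<and> k = j)) = A $ l $ k / 2"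
      by (rule delta)+
    then show ?thesis
      by (simp only: distrib_left sum.distrib)
  qed
  moreover have "A $ k $ l / 2 + A $ l $ k / 2 = A $ k $ l" for k l
    using assms by (metis sym_matrices_iff field_sum_of_halves)
  ultimately show ?thesis
    by (simp add: vec_eq_iff sym_unit_def)
qed

section \<open>Maps fixing the diagonal units are Hadamard products\<close>

lemma image_sym_unit_entry:
  fixes S :: "real ^ 'n ^ 'n \<Rightarrow> real ^ 'n ^ 'n"
  assumes S: "linear_on_sym S"
    and psd: "\<And>A. pos_semidefinite A \<Longrightarrow> pos_semidefinite (S A)"
    and diag: "\<And>i. S (diag_unit i) = diag_unit i"
    and ne: "(k, l) \<noteq> (i, j)" "(k, l) \<noteq> (j, i)"
  shows "S (sym_unit i j) $ k $ l = 0"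
proof -
  let ?F = "sym_unit i j"
  \<comment> \<open>For v = a e_i + b e_j, the form of S (v v^t) at \<open>y\<close> is a quadratic
    polynomial in a and b, nonnegative throughout. Its square coefficients are the squares of
    \<open>y $ i\<close> and \<open>y $ j\<close>, one of which is zero, so the mixed coefficient
    vanishes.\<close>
  have form0: "y \<bullet> (S ?F *v y) = 0" if "y $ i = 0 \<or> y $ j = 0" for y
  proof (rule quadratic_form_vanishes)
    fix a b :: real
    let ?A = "a\<^sup>2 *\<^sub>R diag_unit i + ((a * b) *\<^sub>R ?F + b\<^sup>2 *\<^sub>R diag_unit j)"
    let ?v = "a *\<^sub>R axis i 1 + b *\<^sub>R axis j 1 :: real^'n"
    have "?A $ s $ t = ?v $ s * ?v $ t" for s t
      by (auto simp: diag_unit_def sym_unit_def axis_def power2_eq_square algebra_simps)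
    then have A: "?A = (\<chi> s t. ?v $ s * ?v $ t)" by (simp only: vec_eq_iff vec_lambda_beta) simp
    have "x \<bullet> ((\<chi> s t. ?v $ s * ?v $ t) *v x) = (x \<bullet> ?v)\<^sup>2" for x
      unfolding inner_vec_def matrix_vector_mult_def power2_eq_square
      by (simp add: sum_product sum_distrib_left mult_ac del: vector_add_component vector_scaleR_component)
    then have "pos_semidefinite ?A"
      unfolding A by (simp add: pos_semidefinite_def sym_matrices_iff mult.commute)
    then have "pos_semidefinite (S ?A)" by (rule psd)
    also have "S ?A = a\<^sup>2 *\<^sub>R diag_unit i + ((a * b) *\<^sub>R S ?F + b\<^sup>2 *\<^sub>R diag_unit j)"
      using S diag
      by (simp add: linear_on_sym_def sym_matrices_add sym_matrices_scaleR diag_unit_sym sym_unit_sym)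
    finally have "0 \<le> y \<bullet> ((a\<^sup>2 *\<^sub>R diag_unit i + ((a * b) *\<^sub>R S ?F + b\<^sup>2 *\<^sub>R diag_unit j)) *v y)"
      by (simp add: pos_semidefinite_def)
    then show "0 \<le> a\<^sup>2 * (y $ i)\<^sup>2 + a * b * (y \<bullet> (S ?F *v y)) + b\<^sup>2 * (y $ j)\<^sup>2"
      by (simp add: matrix_vector_mult_add_rdistrib scaleR_matrix_vector_assoc[symmetric]
          inner_add_right inner_diag_unit add.assoc)
  qed (use that in auto)
  have ax: "axis s 1 \<bullet> (S ?F *v axis t 1) = S ?F $ s $ t" for s t
    by (simp add: inner_axis' matrix_vector_mult_basis column_def)
  have symS: "S ?F $ s $ t = S ?F $ t $ s" for s t
    using S sym_unit_sym[of i j] by (auto simp: linear_on_sym_def sym_matrices_iff)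
  have diag0: "S ?F $ m $ m = 0" if "m \<noteq> i \<or> m \<noteq> j" for m
  proof -
    have "axis m (1::real) $ i = 0 \<or> axis m (1::real) $ j = 0"
      using that by (auto simp: axis_def)
    from form0[OF this] show ?thesis by (simp add: ax)
  qed
  \<comment> \<open>For \<open>i = j\<close>, \<open>form0\<close> says nothing about the other
    entries of row \<open>i\<close>; there the image is known directly, as twice a fixed diagonal
    unit.\<close>
  consider "i = j" | "i \<noteq> j" "k = l" | "i \<noteq> j" "k \<noteq> l" by blast
  then show ?thesis
  proof cases
    case 1
    then have F: "?F = 2 *\<^sub>R diag_unit i"
      by (simp add: sym_unit_def diag_unit_def vec_eq_iff)
    have "S ?F = 2 *\<^sub>R diag_unit i"
      using S diag by (simp add: F linear_on_sym_def diag_unit_sym)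
    then show ?thesis using 1 ne by (auto simp: diag_unit_def)
  next
    case 2
    then show ?thesis using diag0[of k] ne by auto
  next
    case 3
    \<comment> \<open>One of \<open>i\<close>, \<open>j\<close> lies outside {k, l}, so e_k + e_l
      vanishes at that index. Evaluating the form there isolates the off-diagonal entry by
      polarization, since the two diagonal entries are already zero.\<close>
    then have "(k \<noteq> i \<and> l \<noteq> i) \<or> (k \<noteq> j \<and> l \<noteq> j)" using ne by auto
    then have "(axis k 1 + axis l 1 :: real^'n) $ i = 0 \<or> (axis k 1 + axis l 1 :: real^'n) $ j = 0"
      by (auto simp: axis_def)
    from form0[OF this] have "S ?F $ k $ k + 2 * S ?F $ k $ l + S ?F $ l $ l = 0"
      by (simp add: matrix_vector_right_distrib inner_add_left inner_add_right ax symS[of l k])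
    moreover have "S ?F $ k $ k = 0" "S ?F $ l $ l = 0"
      using diag0 \<open>(k \<noteq> i \<and> l \<noteq> i) \<or> (k \<noteq> j \<and> l \<noteq> j)\<close> by blast+
    ultimately show ?thesis by simp
  qed
qed

lemma hadamard_if_fixes_diag_unit:
  fixes S :: "real ^ 'n ^ 'n \<Rightarrow> real ^ 'n ^ 'n"
  assumes S: "linear_on_sym S"
    and psd: "\<And>A. pos_semidefinite A \<Longrightarrow> pos_semidefinite (S A)"
    and diag: "\<And>i. S (diag_unit i) = diag_unit i"
  shows "\<exists>H. pos_semidefinite H \<and> (\<forall>i. H $ i $ i = 1) \<and> (\<forall>A\<in>sym_matrices. S A = hadamard H A)"
proof -
  let ?J = "\<chi> i j. 1 :: real ^ 'n ^ 'n"
  have symJ: "?J \<in> sym_matrices" by (simp add: sym_matrices_iff)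
  \<comment> \<open>Only the units with {i, j} = {k, l} can contribute to position (k, l) of the
    image, and their coefficients in \<open>B\<close> are zero.\<close>
  have entry0: "S B $ k $ l = 0" if B: "B \<in> sym_matrices" "B $ k $ l = 0" for B k l
  proof -
    have "S B = S (\<Sum>i\<in>UNIV. \<Sum>j\<in>UNIV. (B $ i $ j / 2) *\<^sub>R sym_unit i j)"
      using sym_matrix_eq_sum[OF B(1)] by simp
    also have "\<dots> = (\<Sum>i\<in>UNIV. \<Sum>j\<in>UNIV. (B $ i $ j / 2) *\<^sub>R S (sym_unit i j))"
      using S by (simp add: linear_on_sym_sum[OF S] sym_matrices_sum sym_matrices_scaleR sym_unit_sym
          linear_on_sym_def)
    finally have "S B $ k $ l = (\<Sum>i\<in>UNIV. \<Sum>j\<in>UNIV. B $ i $ j / 2 * S (sym_unit i j) $ k $ l)"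
      by simp
    also have "\<dots> = 0"
    proof (intro sum.neutral ballI)
      fix i j
      have "B $ l $ k = 0" using B by (simp add: sym_matrices_iff)
      then show "B $ i $ j / 2 * S (sym_unit i j) $ k $ l = 0"
        using B(2) image_sym_unit_entry[OF S psd diag, of k l i j] by auto
    qed
    finally show ?thesis .
  qed
  have entry: "S A $ k $ l = A $ k $ l * S ?J $ k $ l" if A: "A \<in> sym_matrices" for A k l
  proof -
    \<comment> \<open>Subtracting the multiple of the all-ones matrix that cancels entry (k, l)
      reduces the claim to \<open>entry0\<close>.\<close>
    let ?B = "A + (- A $ k $ l) *\<^sub>R ?J"
    have "S ?B = S A + (- A $ k $ l) *\<^sub>R S ?J"
      using S A symJ sym_matrices_scaleR unfolding linear_on_sym_def by metis
    moreover have "S ?B $ k $ l = 0"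
      using A symJ by (intro entry0 sym_matrices_add sym_matrices_scaleR) simp_all
    ultimately show ?thesis by simp
  qed
  have "x \<bullet> (?J *v x) = (\<Sum>i\<in>UNIV. x $ i)\<^sup>2" for x
    by (simp add: inner_vec_def matrix_vector_mult_def power2_eq_square sum_distrib_right)
  then have "pos_semidefinite ?J"
    using symJ by (simp add: pos_semidefinite_def)
  \<comment> \<open>Compares the (i, i) entries of the two sides of S E_ii = E_ii.\<close>
  moreover have "S ?J $ i $ i = 1" for i
    using entry[of "diag_unit i" i i] diag by (simp add: diag_unit_def sym_matrices_iff conj_commute)
  moreover have "S A = hadamard (S ?J) A" if "A \<in> sym_matrices" for A
    using entry[OF that] by (simp add: vec_eq_iff hadamard_def mult.commute)
  ultimately show ?thesis using psd by blast
qed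

section \<open>Reduction to a map fixing the diagonal units\<close>

theorem theorem11:
  fixes T :: "real ^ 'n ^ 'n \<Rightarrow> real ^ 'n ^ 'n"
  assumes "linear_on_sym T"
    and "preserves_pos_definite T"
    and "\<And>i :: 'n. rank (T (diag_unit i)) = 1"
  shows "\<exists>(W :: real ^ 'n ^ 'n) (H :: real ^ 'n ^ 'n).
           invertible W \<and> pos_semidefinite H \<and> (\<forall>i. H $ i $ i = 1) \<and>
           (\<forall>A \<in> sym_matrices. T A = W ** hadamard H A ** transpose W)"
proof -
  \<comment> \<open>Congruence by \<open>M\<close> sends E_ii to the outer square of column
    \<open>i\<close>, so a matrix with columns w_i reproduces every T E_ii.\<close>
  have entries: "(M ** diag_unit i ** transpose M) $ k $ l = M $ k $ i * M $ l $ i"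
    for M :: "real^'n^'n" and i k l
  proof -
    have *: "(M ** diag_unit i) $ k $ j = (if j = i then M $ k $ i else 0)" for j
      by (cases "j = i") (simp_all add: diag_unit_def matrix_matrix_mult_def if_distrib cong: if_cong)
    then show ?thesis
      by (simp add: matrix_matrix_mult_def[of "M ** diag_unit i"] transpose_def * if_distrib
          if_distribR cong: if_cong)
  qed
  have "pos_semidefinite (diag_unit i)" for i :: 'n
    by (simp add: pos_semidefinite_def diag_unit_sym inner_diag_unit)
  then have "\<exists>w. T (diag_unit i) = (\<chi> k l. w $ k * w $ l)" for i
    using pos_semidefinite_rank_1 pos_semidefinite_image assms by blast
  then obtain w where w: "\<And>i. T (diag_unit i) = (\<chi> k l. w i $ k * w i $ l)" by metis
  define W :: "real^'n^'n" where "W = (\<chi> k i. w i $ k)"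
  have TE: "T (diag_unit i) = W ** diag_unit i ** transpose W" for i
    by (simp add: vec_eq_iff entries w) (simp add: W_def)
  have I: "mat 1 = (\<Sum>i\<in>UNIV. diag_unit i :: real^'n^'n)"
    by (simp add: vec_eq_iff mat_def diag_unit_def of_bool_conj flip: of_bool_def)
  have "T (mat 1) = (\<Sum>i\<in>UNIV. W ** diag_unit i ** transpose W)"
    by (simp add: I linear_on_sym_sum[OF assms(1)] diag_unit_sym TE)
  also have "\<dots> = W ** mat 1 ** transpose W"
    by (simp add: vec_eq_iff entries) (simp add: matrix_matrix_mult_def transpose_def)
  finally have TI: "T (mat 1) = W ** mat 1 ** transpose W" .
  have "pos_definite (mat 1 :: real^'n^'n)"
    by (simp add: pos_definite_def sym_matrices_def)
  then have pdI: "pos_definite (W ** mat 1 ** transpose W)"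
    using assms(2) TI unfolding preserves_pos_definite_def by metis
  \<comment> \<open>The form of \<open>T (mat 1)\<close> at \<open>x\<close> is the squared norm of
    \<open>transpose W *v x\<close>, and positive definiteness lets it vanish only at 0.\<close>
  have "x = 0" if "transpose W *v x = 0" for x
    using pdI that unfolding pos_definite_def inner_congruence by force
  then have "invertible (transpose W)"
    by (metis invertible_left_inverse matrix_left_invertible_ker)
  then have inv: "invertible W"
    by (metis transpose_invertible transpose_transpose)
  then obtain V where V: "V ** W = mat 1" "W ** V = mat 1"
    by (auto simp: invertible_def)
  have Vt: "transpose W ** transpose V = mat 1" "transpose V ** transpose W = mat 1"
    using V by (simp_all add: matrix_transpose_mul[symmetric])
  define S where "S A = V ** T A ** transpose V" for A
  have add_mul: "(A + B) ** C = A ** C + B ** C" for A B C :: "real^'n^'n"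
    by (simp add: matrix_matrix_mult_def vec_eq_iff distrib_right sum.distrib)
  have "linear_on_sym S"
    using assms(1)
    by (simp add: linear_on_sym_def S_def matrix_add_ldistrib add_mul sym_matrices_def
        matrix_transpose_mul matrix_mul_assoc matrix_scalar_ac scalar_matrix_assoc)
  moreover have "pos_semidefinite (S A)" if "pos_semidefinite A" for A
    using pos_semidefinite_image[OF assms(1,2) that]
    by (simp add: pos_semidefinite_def S_def inner_congruence sym_matrices_def
        matrix_transpose_mul matrix_mul_assoc)
  moreover have "S (diag_unit i) = diag_unit i" for i
  proof -
    have "S (diag_unit i) = (V ** W) ** diag_unit i ** (transpose W ** transpose V)"
      by (simp only: S_def TE matrix_mul_assoc)
    then show ?thesis by (simp add: V Vt)
  qed
  ultimately obtain H where H: "pos_semidefinite H" "\<forall>i. H $ i $ i = 1"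
      "\<forall>A\<in>sym_matrices. S A = hadamard H A"
    using hadamard_if_fixes_diag_unit by blast
  have TS: "T A = W ** S A ** transpose W" for A
  proof -
    have "W ** S A ** transpose W = (W ** V) ** T A ** (transpose V ** transpose W)"
      by (simp only: S_def matrix_mul_assoc)
    then show ?thesis by (simp add: V Vt)
  qed
  have "\<forall>A\<in>sym_matrices. T A = W ** hadamard H A ** transpose W"
    using H(3) TS by simp
  with H(1,2) inv show ?thesis by blast
qed

end
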